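(* Let $n\ge 2$, let $(X,g)$ be an $n$-dimensional smooth connected Riemannian manifold without boundary, and let $Y$ be an $n$-dimensional compact connected $C^0$-submanifold in $X$ with nonempty boundary $\partial Y$. For $x,y\in Y$ put $$\rho_Y(x,y)=\liminf_{x'\to x,\ y'\to y;\ x',y'\in \operatorname{Int} Y}\ \inf\{\, l(\gamma) : \gamma:[0,1]\to \operatorname{Int} Y \text{ a smooth path with } \gamma(0)=x',\ \gamma(1)=y'\,\}.$$ Assume that $\rho_Y$ is a finite function and is a metric on $Y$. Then any two points $x,y\in Y$ can be joined in $Y$ by a shortest curve in the metric $\rho_Y$; that is, there exist $L\ge 0$ and a curve $\gamma:[0,L]\to Y$ such that $\gamma(0)=x$, $\gamma(L)=y$, and $$\rho_Y(\gamma(s),\gamma(t))=t-s\qquad\text{for all } s,t\in[0,L] \text{ with } s<t.$$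
   Context: An $n$-dimensional $C^0$-submanifold $Y$ with boundary in an $n$-dimensional manifold $X$ is a subset $Y\subset X$ which, with the topology induced from $X$, is a topological $n$-manifold with boundary; $\partial Y$ denotes its boundary and $\operatorname{Int} Y = Y\setminus\partial Y$ its interior. The length $l(\gamma)$ of a path is computed in the Riemannian metric $g$. The points $x',y'$ in the lower limit range over $\operatorname{Int} Y$, and convergence $x'\to x$, $y'\to y$ is in the topology of $X$. *)

theory Defs
  imports "HOL-Analysis.Analysis"
begin

section \<open>Smooth maps\<close>

text \<open>
  Classical \<open>C\<^sup>k\<close> differentiability on an open set. The domain is meant to be finite-dimensional, so
  that continuity of all directional derivatives of order \<open>\<le> k\<close> is the usual \<open>C\<^sup>k\<close> condition.
\<close>

fun Ck_on :: "nat \<Rightarrow> 'a::real_normed_vector set \<Rightarrow> ('a \<Rightarrow> 'b::real_normed_vector) \<Rightarrow> bool" where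
  "Ck_on 0 S f \<longleftrightarrow> continuous_on S f"
| "Ck_on (Suc k) S f \<longleftrightarrow>
     (\<forall>x\<in>S. f differentiable (at x)) \<and> (\<forall>v. Ck_on k S (\<lambda>x. frechet_derivative f (at x) v))"

text \<open>
  Smoothness on an arbitrary set: near each point of \<open>S\<close> the map extends to a \<open>C\<^sup>\<infinity>\<close> map on an open
  neighbourhood. On open sets this is ordinary smoothness; on an interval it is smoothness up to
  the end points.
\<close>

definition smooth_on :: "'a::real_normed_vector set \<Rightarrow> ('a \<Rightarrow> 'b::real_normed_vector) \<Rightarrow> bool" where
  "smooth_on S f \<longleftrightarrow>
     (\<forall>x\<in>S. \<exists>N F. open N \<and> x \<in> N \<and> (\<forall>k. Ck_on k N F) \<and> (\<forall>y \<in> S \<inter> N. F y = f y))"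


section \<open>Smooth and Riemannian manifolds\<close>

text \<open>
  The model space \<open>'e\<close> plays the role of \<open>\<real>\<^sup>n\<close>, with \<open>n = DIM('e)\<close>. Only the values of a chart map on
  the chart domain matter.
\<close>

type_synonym ('a, 'e) chart = "'a set \<times> ('a \<Rightarrow> 'e)"

definition is_chart :: "'a topology \<Rightarrow> ('a, 'e::euclidean_space) chart \<Rightarrow> bool" where
  "is_chart X = (\<lambda>(U, \<phi>). openin X U \<and> open (\<phi> ` U) \<and>
     homeomorphic_map (subtopology X U) (top_of_set (\<phi> ` U)) \<phi>)"

definition transition :: "('a, 'e) chart \<Rightarrow> ('a, 'e) chart \<Rightarrow> 'e \<Rightarrow> 'e" where
  "transition c c' = snd c' \<circ> inv_into (fst c) (snd c)"

text \<open>
  The atlas need not be maximal: smooth paths, Riemannian metrics and lengths with respect to an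
  atlas agree with those of the smooth structure it generates.
\<close>

locale smooth_manifold =
  fixes X :: "'a topology" and A :: "('a, 'e::euclidean_space) chart set"
  assumes Hausdorff: "Hausdorff_space X"
    and second_countable: "second_countable X"
    and charts: "\<And>c. c \<in> A \<Longrightarrow> is_chart X c"
    and covers: "(\<Union>c\<in>A. fst c) = topspace X"
    and compatible: "\<And>c c'. \<lbrakk>c \<in> A; c' \<in> A\<rbrakk> \<Longrightarrow>
          smooth_on (snd c ` (fst c \<inter> fst c')) (transition c c')"

text \<open>
  A Riemannian metric is given by its coordinate representations: \<open>g c p v w\<close> is the inner product
  of the tangent vectors at \<open>p\<close> whose coordinates in the chart \<open>c\<close> are \<open>v\<close> and \<open>w\<close>. The assumption
  \<open>metric_transforms\<close>, the transformation law of covariant 2-tensors, says that the representations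
  in different charts define one and the same inner product on the tangent space at \<open>p\<close>.
\<close>

locale riemannian_manifold = smooth_manifold X A
  for X :: "'a topology" and A :: "('a, 'e::euclidean_space) chart set" +
  fixes g :: "('a, 'e) chart \<Rightarrow> 'a \<Rightarrow> 'e \<Rightarrow> 'e \<Rightarrow> real"
  assumes metric_bilinear: "\<And>c p. \<lbrakk>c \<in> A; p \<in> fst c\<rbrakk> \<Longrightarrow> bilinear (g c p)"
    and metric_sym: "\<And>c p v w. \<lbrakk>c \<in> A; p \<in> fst c\<rbrakk> \<Longrightarrow> g c p v w = g c p w v"
    and metric_pos: "\<And>c p v. \<lbrakk>c \<in> A; p \<in> fst c; v \<noteq> 0\<rbrakk> \<Longrightarrow> 0 < g c p v v"
    and metric_smooth: "\<And>c v w. c \<in> A \<Longrightarrow>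
          smooth_on (snd c ` fst c) (\<lambda>u. g c (inv_into (fst c) (snd c) u) v w)"
    and metric_transforms: "\<And>c c' p v w. \<lbrakk>c \<in> A; c' \<in> A; p \<in> fst c; p \<in> fst c'\<rbrakk> \<Longrightarrow>
          g c p v w = g c' p (frechet_derivative (transition c c') (at (snd c p)) v)
                             (frechet_derivative (transition c c') (at (snd c p)) w)"


section \<open>Smooth paths and their length\<close>

definition smooth_path ::
  "'a topology \<Rightarrow> ('a, 'e::euclidean_space) chart set \<Rightarrow> (real \<Rightarrow> 'a) \<Rightarrow> bool" where
  "smooth_path X A \<gamma> \<longleftrightarrow>
     pathin X \<gamma> \<and> (\<forall>c\<in>A. smooth_on {t \<in> {0..1}. \<gamma> t \<in> fst c} (snd c \<circ> \<gamma>))"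

text \<open>
  The norm of the velocity vector of \<open>\<gamma>\<close> at \<open>t\<close>, computed in some chart around \<open>\<gamma> t\<close>. By
  \<open>metric_transforms\<close> the value does not depend on the chart.
\<close>

definition speed ::
  "('a, 'e::euclidean_space) chart set \<Rightarrow> (('a, 'e) chart \<Rightarrow> 'a \<Rightarrow> 'e \<Rightarrow> 'e \<Rightarrow> real) \<Rightarrow>
   (real \<Rightarrow> 'a) \<Rightarrow> real \<Rightarrow> real" where
  "speed A g \<gamma> t =
     (let c = (SOME c. c \<in> A \<and> \<gamma> t \<in> fst c);
          v = vector_derivative (snd c \<circ> \<gamma>) (at t within {0..1})
      in sqrt (g c (\<gamma> t) v v))"

definition path_len ::
  "('a, 'e::euclidean_space) chart set \<Rightarrow> (('a, 'e) chart \<Rightarrow> 'a \<Rightarrow> 'e \<Rightarrow> 'e \<Rightarrow> real) \<Rightarrow>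
   (real \<Rightarrow> 'a) \<Rightarrow> real" where
  "path_len A g \<gamma> = integral {0..1} (speed A g \<gamma>)"


section \<open>Topological manifolds with boundary\<close>

text \<open>
  A chart into the closed half-space \<open>{v. 0 \<le> v \<bullet> b}\<close>. Half-spaces for different \<open>b \<in> Basis\<close> differ by a
  permutation of the coordinates. Charts onto open subsets of the whole model space are covered up
  to shrinking and a translation into the open half-space.
\<close>

definition is_half_chart ::
  "'a topology \<Rightarrow> 'e::euclidean_space \<Rightarrow> ('a, 'e) chart \<Rightarrow> bool" where
  "is_half_chart M b = (\<lambda>(U, \<phi>). openin M U \<and> openin (top_of_set {v. 0 \<le> v \<bullet> b}) (\<phi> ` U) \<and>
     homeomorphic_map (subtopology M U) (top_of_set (\<phi> ` U)) \<phi>)"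

definition manifold_with_boundary :: "'e::euclidean_space itself \<Rightarrow> 'a topology \<Rightarrow> bool" where
  "manifold_with_boundary _ M \<longleftrightarrow> Hausdorff_space M \<and> second_countable M \<and>
     (\<forall>p\<in>topspace M. \<exists>b\<in>Basis. \<exists>c :: ('a, 'e) chart. is_half_chart M b c \<and> p \<in> fst c)"

definition manifold_boundary :: "'e::euclidean_space itself \<Rightarrow> 'a topology \<Rightarrow> 'a set" where
  "manifold_boundary _ M =
     {p. \<exists>b\<in>Basis. \<exists>c :: ('a, 'e) chart. is_half_chart M b c \<and> p \<in> fst c \<and> snd c p \<bullet> b = 0}"

definition manifold_interior :: "'e::euclidean_space itself \<Rightarrow> 'a topology \<Rightarrow> 'a set" where
  "manifold_interior e M = topspace M - manifold_boundary e M"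

definition C0_submanifold :: "'e::euclidean_space itself \<Rightarrow> 'a topology \<Rightarrow> 'a set \<Rightarrow> bool" where
  "C0_submanifold e X Y \<longleftrightarrow> Y \<subseteq> topspace X \<and> manifold_with_boundary e (subtopology X Y)"


section \<open>The intrinsic distance of a submanifold\<close>

text \<open>Extended real values: the infimum over the empty set of paths is \<open>\<infinity>\<close>.\<close>

definition path_dist ::
  "'a topology \<Rightarrow> ('a, 'e::euclidean_space) chart set \<Rightarrow>
   (('a, 'e) chart \<Rightarrow> 'a \<Rightarrow> 'e \<Rightarrow> 'e \<Rightarrow> real) \<Rightarrow> 'a set \<Rightarrow> 'a \<Rightarrow> 'a \<Rightarrow> ereal" where
  "path_dist X A g S x y =
     (INF \<gamma> \<in> {\<gamma>. smooth_path X A \<gamma> \<and> \<gamma> ` {0..1} \<subseteq> S \<and> \<gamma> 0 = x \<and> \<gamma> 1 = y}. ereal (path_len A g \<gamma>))"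

text \<open>The neighbourhoods are not punctured: \<open>x' = x\<close> and \<open>y' = y\<close> are admitted in the lower limit.\<close>

definition rho ::
  "'a topology \<Rightarrow> ('a, 'e::euclidean_space) chart set \<Rightarrow>
   (('a, 'e) chart \<Rightarrow> 'a \<Rightarrow> 'e \<Rightarrow> 'e \<Rightarrow> real) \<Rightarrow> 'a set \<Rightarrow> 'a \<Rightarrow> 'a \<Rightarrow> ereal" where
  "rho X A g Y x y =
     (let I = manifold_interior TYPE('e) (subtopology X Y)
      in Liminf (inf (nhdsin X x) (principal I) \<times>\<^sub>F inf (nhdsin X y) (principal I))
           (\<lambda>(x', y'). path_dist X A g I x' y'))"

end

theory Submission
  imports Defs
begin

text \<open>
  A nearly optimal smooth path in the interior, parametrized proportionally to arc length, is a
  geodesic of \<open>path_dist\<close> up to a small error. Since \<open>Y\<close> is compact, such paths with end points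
  tending to \<open>x\<close> and \<open>y\<close> have a pointwise cluster point \<open>\<gamma>\<close>, and by the definition of \<open>rho\<close> as a lower
  limit \<open>\<gamma>\<close> satisfies \<open>rho (\<gamma> s) (\<gamma> t) \<le> t - s\<close>. The triangle inequality for \<open>rho\<close> forces equality.
  Continuity of \<open>\<gamma>\<close> in the topology of \<open>X\<close> follows from lower semicontinuity of \<open>rho\<close> and
  compactness.
\<close>

section \<open>Shortest curves for lower limits of length distances\<close>

text \<open>\<open>rho\<close> is the instance where \<open>I\<close> is the interior of
  \<open>Y\<close> and \<open>D\<close> is \<open>path_dist\<close> on \<open>I\<close>. Leaving
  \<open>D\<close> arbitrary separates the compactness argument from Riemannian geometry.\<close>

definition liminf_dist :: "'a topology \<Rightarrow> 'a set \<Rightarrow> ('a \<Rightarrow> 'a \<Rightarrow> ereal) \<Rightarrow> 'a \<Rightarrow> 'a \<Rightarrow> ereal" where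
  "liminf_dist X I D x y =
     Liminf (inf (nhdsin X x) (principal I) \<times>\<^sub>F inf (nhdsin X y) (principal I)) (\<lambda>(x', y'). D x' y')"

lemma less_liminf_distE:
  assumes "c < liminf_dist X I D x y" "x \<in> topspace X" "y \<in> topspace X"
  obtains U V where "openin X U" "x \<in> U" "openin X V" "y \<in> V"
    "\<And>x' y'. x' \<in> U \<inter> I \<Longrightarrow> y' \<in> V \<inter> I \<Longrightarrow> c < D x' y'"
proof -
  have "eventually (\<lambda>p. c < (case p of (x', y') \<Rightarrow> D x' y'))
          (inf (nhdsin X x) (principal I) \<times>\<^sub>F inf (nhdsin X y) (principal I))"
    using assms(1) le_Liminf_iff unfolding liminf_dist_def by blast
  then obtain P Q where P: "eventually P (inf (nhdsin X x) (principal I))"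
    and Q: "eventually Q (inf (nhdsin X y) (principal I))"
    and PQ: "\<And>x' y'. P x' \<Longrightarrow> Q y' \<Longrightarrow> c < D x' y'"
    by (auto simp: eventually_prod_filter)
  obtain U where "openin X U" "x \<in> U" "\<And>z. z \<in> U \<inter> I \<Longrightarrow> P z"
    using P assms(2) by (auto simp: eventually_inf_principal eventually_nhdsin)
  moreover obtain V where "openin X V" "y \<in> V" "\<And>z. z \<in> V \<inter> I \<Longrightarrow> Q z"
    using Q assms(3) by (auto simp: eventually_inf_principal eventually_nhdsin)
  ultimately show thesis
    using that PQ by meson
qed

lemma liminf_dist_geI:
  assumes "openin X U" "x \<in> U" "openin X V" "y \<in> V"
    and "\<And>x' y'. x' \<in> U \<inter> I \<Longrightarrow> y' \<in> V \<inter> I \<Longrightarrow> c \<le> D x' y'"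
  shows "c \<le> liminf_dist X I D x y"
  unfolding liminf_dist_def
proof (rule Liminf_bounded)
  have "eventually (\<lambda>z. z \<in> U \<inter> I) (inf (nhdsin X x) (principal I))"
    "eventually (\<lambda>z. z \<in> V \<inter> I) (inf (nhdsin X y) (principal I))"
    using assms by (auto simp: eventually_inf_principal eventually_nhdsin)
  then show "eventually (\<lambda>p. c \<le> (case p of (x', y') \<Rightarrow> D x' y'))
          (inf (nhdsin X x) (principal I) \<times>\<^sub>F inf (nhdsin X y) (principal I))"
    unfolding eventually_prod_filter using assms(5) by auto
qed

text \<open>Open sets \<open>U\<close> and \<open>V\<close> that witness a lower bound for
  \<open>D\<close> near \<open>x\<close> and \<open>y\<close> are neighbourhoods of all their other
  points as well, so they bound the lower limit at each of these.\<close>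

lemma liminf_dist_lower_semicontinuous:
  assumes "c < liminf_dist X I D x y" "x \<in> topspace X" "y \<in> topspace X"
  obtains U V where "openin X U" "x \<in> U" "openin X V" "y \<in> V"
    "\<And>x' y'. x' \<in> U \<Longrightarrow> y' \<in> V \<Longrightarrow> c \<le> liminf_dist X I D x' y'"
proof -
  obtain U V where UV: "openin X U" "x \<in> U" "openin X V" "y \<in> V"
    "\<And>x' y'. x' \<in> U \<inter> I \<Longrightarrow> y' \<in> V \<inter> I \<Longrightarrow> c < D x' y'"
    using less_liminf_distE[OF assms] by metis
  show thesis
  proof (rule that[OF UV(1-4)])
    fix x' y' assume "x' \<in> U" "y' \<in> V"
    then show "c \<le> liminf_dist X I D x' y'"
      using UV by (intro liminf_dist_geI[of X U _ V]) (auto intro: less_imp_le)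
  qed
qed

text \<open>On a compact set the lower semicontinuous metric \<open>liminf_dist\<close> is bounded away from \<open>0\<close> off
  every neighbourhood of a point, so it induces a topology at least as fine as that of \<open>X\<close>.\<close>

lemma lipschitz_into_liminf_dist_continuous:
  fixes \<gamma> :: "real \<Rightarrow> 'a"
  assumes Y: "compactin X Y" and \<gamma>: "\<And>s. s \<in> S \<Longrightarrow> \<gamma> s \<in> Y"
    and pos: "\<And>p q. p \<in> Y \<Longrightarrow> q \<in> Y \<Longrightarrow> p \<noteq> q \<Longrightarrow> 0 < liminf_dist X I D p q"
    and le: "\<And>s t. s \<in> S \<Longrightarrow> t \<in> S \<Longrightarrow> liminf_dist X I D (\<gamma> s) (\<gamma> t) \<le> ereal \<bar>s - t\<bar>"
  shows "continuous_map (top_of_set S) (subtopology X Y) \<gamma>"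
proof -
  have YX: "Y \<subseteq> topspace X"
    using Y compactin_subset_topspace by blast
  have "topcontinuous_at (top_of_set S) X \<gamma> t" if t: "t \<in> S" for t
    unfolding topcontinuous_at_def
  proof (intro conjI allI impI)
    show "t \<in> topspace (top_of_set S)" "\<gamma> \<in> topspace (top_of_set S) \<rightarrow> topspace X"
      using t \<gamma> YX by auto
    fix W assume W: "openin X W \<and> \<gamma> t \<in> W"
    \<comment> \<open>Every point of \<open>Y\<close> outside \<open>W\<close> has a neighbourhood
      at a definite distance from \<open>\<gamma> t\<close>; compactness of \<open>Y - W\<close>
      then yields one bound \<open>e\<close> for all of them.\<close>
    have "\<exists>U c. openin X U \<and> p \<in> U \<and> 0 < c \<and>
            (\<forall>p'\<in>U. ereal c \<le> liminf_dist X I D p' (\<gamma> t))" if p: "p \<in> Y - W" for p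
    proof -
      have "0 < liminf_dist X I D p (\<gamma> t)"
        using p t W \<gamma> by (intro pos) auto
      then obtain c where c: "0 < ereal c" "ereal c < liminf_dist X I D p (\<gamma> t)"
        using ereal_dense2 by blast
      then show ?thesis
        using liminf_dist_lower_semicontinuous[OF c(2)] p YX \<gamma>[OF t]
        by (metis DiffD1 ereal_less(2) subsetD)
    qed
    then obtain U c where Uc: "\<And>p. p \<in> Y - W \<Longrightarrow> openin X (U p) \<and> p \<in> U p \<and> 0 < c p \<and>
            (\<forall>p'\<in>U p. ereal (c p) \<le> liminf_dist X I D p' (\<gamma> t))"
      by metis
    have "Y - W = (topspace X - W) \<inter> Y"
      using YX by blast
    then have "compactin X (Y - W)"
      using Y W by (metis closed_Int_compactin closedin_diff closedin_topspace)
    moreover have "\<forall>V\<in>U ` (Y - W). openin X V" "Y - W \<subseteq> \<Union> (U ` (Y - W))"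
      using Uc by blast+
    ultimately obtain \<V> where "finite \<V>" "\<V> \<subseteq> U ` (Y - W)" "Y - W \<subseteq> \<Union>\<V>"
      unfolding compactin_def by meson
    then obtain F where F: "finite F" "F \<subseteq> Y - W" "Y - W \<subseteq> \<Union> (U ` F)"
      using finite_subset_image by metis
    \<comment> \<open>The element 1 keeps the minimum meaningful when \<open>F\<close> is empty,
      which happens if \<open>Y\<close> lies in \<open>W\<close>.\<close>
    define e where "e = Min (insert 1 (c ` F))"
    have e: "0 < e" "\<And>p. p \<in> F \<Longrightarrow> e \<le> c p"
      using F Uc by (auto simp: e_def)
    have "\<gamma> s \<in> W" if s: "s \<in> S" "dist s t < e" for s
    proof (rule ccontr)
      assume "\<gamma> s \<notin> W"
      then have "\<gamma> s \<in> Y - W"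
        using \<gamma>[OF s(1)] by simp
      then obtain p where p: "p \<in> F" "\<gamma> s \<in> U p"
        using F(3) by blast
      then have "ereal (c p) \<le> ereal \<bar>s - t\<bar>"
        using Uc F(2) le[OF s(1) t] by (meson order_trans subsetD)
      then show False
        using e(2)[OF p(1)] s(2) by (simp add: dist_real_def)
    qed
    then show "\<exists>U. openin (top_of_set S) U \<and> t \<in> U \<and> (\<forall>y\<in>U. \<gamma> y \<in> W)"
      using e(1) t by (intro exI[of _ "S \<inter> ball t e"]) (auto simp: dist_commute)
  qed
  then have "continuous_map (top_of_set S) X \<gamma>"
    by (simp add: continuous_map_eq_topcontinuous_at)
  then show ?thesis
    using \<gamma> by (auto simp: continuous_map_in_subtopology)
qed

text \<open>Curves that are geodesic up to \<open>\<epsilon>\<close> have a cluster point in the compact product \<open>Y\<^bsup>{0..d}\<^esup>\<close>; this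
  replaces the Arzela-Ascoli argument.\<close>

lemma almost_geodesics_cluster:
  fixes d :: real
  assumes X: "Hausdorff_space X" and Y: "compactin X Y" and IY: "I \<subseteq> Y"
    and x: "x \<in> Y" and y: "y \<in> Y" and d: "0 \<le> d"
    and ex: "\<And>U V e. openin X U \<Longrightarrow> x \<in> U \<Longrightarrow> openin X V \<Longrightarrow> y \<in> V \<Longrightarrow> 0 < e \<Longrightarrow>
      \<exists>z. z 0 \<in> U \<and> z d \<in> V \<and> (\<forall>s\<in>{0..d}. z s \<in> I) \<and>
        (\<forall>s\<in>{0..d}. \<forall>t\<in>{0..d}. s \<le> t \<longrightarrow> D (z s) (z t) \<le> ereal (t - s + e))"
  obtains \<gamma> where "\<gamma> 0 = x" "\<gamma> d = y" "\<And>s. s \<in> {0..d} \<Longrightarrow> \<gamma> s \<in> Y"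
    "\<And>s t. s \<in> {0..d} \<Longrightarrow> t \<in> {0..d} \<Longrightarrow> s \<le> t \<Longrightarrow>
       liminf_dist X I D (\<gamma> s) (\<gamma> t) \<le> ereal (t - s)"
proof -
  have YX: "Y \<subseteq> topspace X"
    using Y compactin_subset_topspace by blast
  \<comment> \<open>The points of \<open>P\<close> are arbitrary functions into \<open>Y\<close>,
    continuous or not, so compactness is Tychonoff's theorem. Continuity of the limit curve is
    recovered later from the Lipschitz bound.\<close>
  define P where "P = product_topology (\<lambda>_. subtopology X Y) {0..d}"
  have P: "compact_space P"
    unfolding P_def using Y by (simp add: compact_space_product_topology compact_space_subtopology)
  have topP: "topspace P = {0..d} \<rightarrow>\<^sub>E Y"
    using YX by (auto simp: P_def Int_absorb1)
  define Q where "Q = (\<lambda>(U, V, e). {z \<in> {0..d} \<rightarrow>\<^sub>E I. z 0 \<in> U \<and> z d \<in> V \<and>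
        (\<forall>s\<in>{0..d}. \<forall>t\<in>{0..d}. s \<le> t \<longrightarrow> D (z s) (z t) \<le> ereal (t - s + e))})"
  define N where "N = {(U, V, e::real). openin X U \<and> x \<in> U \<and> openin X V \<and> y \<in> V \<and> 0 < e}"
  have Q_ne: "Q u \<noteq> {}" if u: "u \<in> N" for u
  proof -
    obtain U V e where u_eq: "u = (U, V, e)"
      by (metis prod_cases3)
    then obtain z where z: "z 0 \<in> U \<and> z d \<in> V \<and> (\<forall>s\<in>{0..d}. z s \<in> I) \<and>
        (\<forall>s\<in>{0..d}. \<forall>t\<in>{0..d}. s \<le> t \<longrightarrow> D (z s) (z t) \<le> ereal (t - s + e))"
      using ex[of U V e] u by (auto simp: N_def)
    then have "restrict z {0..d} \<in> Q u"
      using d by (auto simp: Q_def u_eq)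
    then show ?thesis
      by auto
  qed
  have Q_sub: "Q u \<subseteq> topspace P" for u
    using IY by (cases u) (auto simp: Q_def topP)
  \<comment> \<open>Intersecting neighbourhoods and taking the smaller tolerance makes the sets
    \<open>Q u\<close> directed. As each is nonempty, their closures have the finite intersection
    property.\<close>
  have directed: "\<exists>u\<in>N. Q u \<subseteq> topspace P \<inter> \<Inter> ((\<lambda>u. P closure_of Q u) ` F)"
    if "finite F" "F \<subseteq> N" for F
    using that
  proof (induction F)
    case empty
    have "(topspace X, topspace X, 1) \<in> N"
      using x y YX by (auto simp: N_def)
    then show ?case
      using Q_sub by blast
  next
    case (insert v F)
    then obtain u where u: "u \<in> N" "Q u \<subseteq> topspace P \<inter> \<Inter> ((\<lambda>u. P closure_of Q u) ` F)"
      by auto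
    obtain U V e U' V' e' where eq: "u = (U, V, e)" "v = (U', V', e')"
      by (metis prod_cases3)
    let ?w = "(U \<inter> U', V \<inter> V', min e e')"
    have w: "?w \<in> N"
      using u(1) insert.prems by (auto simp: N_def eq)
    have "b \<le> ereal (t - s + e)" "b \<le> ereal (t - s + e')"
      if "b \<le> ereal (t - s + min e e')" for b s t
      using that by (auto elim!: order_trans)
    then have "Q ?w \<subseteq> Q u" "Q ?w \<subseteq> Q v"
      unfolding Q_def eq by blast+
    then have "Q ?w \<subseteq> topspace P \<inter> \<Inter> ((\<lambda>u. P closure_of Q u) ` insert v F)"
      using u(2) closure_of_subset[OF Q_sub, of v] by auto
    then show ?case
      using w by blast
  qed
  have "\<Inter> ((\<lambda>u. P closure_of Q u) ` N) \<noteq> {}"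
  proof -
    have "\<Inter>\<F> \<noteq> {}" if \<F>: "finite \<F>" "\<F> \<subseteq> (\<lambda>u. P closure_of Q u) ` N" for \<F>
    proof -
      obtain F where "finite F" "F \<subseteq> N" "\<F> = (\<lambda>u. P closure_of Q u) ` F"
        using finite_subset_image[OF \<F>] by blast
      then obtain u where "u \<in> N" "Q u \<subseteq> \<Inter>\<F>"
        using directed[of F] by auto
      then show ?thesis
        using Q_ne[of u] by auto
    qed
    then show ?thesis
      using P[unfolded compact_space_fip, rule_format, of "(\<lambda>u. P closure_of Q u) ` N"] by auto
  qed
  then obtain \<gamma> where \<gamma>: "\<And>u. u \<in> N \<Longrightarrow> \<gamma> \<in> P closure_of Q u"
    by blast
  have top: "(topspace X, topspace X, 1) \<in> N"
    using x y YX by (auto simp: N_def)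
  have \<gamma>P: "\<gamma> \<in> topspace P"
    using \<gamma>[OF top] by (simp add: in_closure_of)
  then have \<gamma>Y: "\<gamma> s \<in> Y" if "s \<in> {0..d}" for s
    using that by (auto simp: topP)
  \<comment> \<open>A basic neighbourhood in the product restricts finitely many coordinates. Two
    suffice, since the estimate on \<open>D\<close> compares the curve at two parameters
    only.\<close>
  have near: "\<exists>z\<in>Q u. z s \<in> U \<and> z t \<in> V"
    if u: "u \<in> N" "s \<in> {0..d}" "t \<in> {0..d}" "openin X U" "\<gamma> s \<in> U" "openin X V" "\<gamma> t \<in> V" for u s t U V
  proof -
    have "openin P {z \<in> topspace P. z r \<in> W}" if "r \<in> {0..d}" "openin X W" for r W
    proof -
      have "continuous_map P X (\<lambda>z. z r)"
        using continuous_map_product_projection[OF that(1), of "\<lambda>_. subtopology X Y"]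
        by (auto simp: P_def continuous_map_in_subtopology)
      then show ?thesis
        using that(2) openin_continuous_map_preimage by blast
    qed
    then have "openin P ({z \<in> topspace P. z s \<in> U} \<inter> {z \<in> topspace P. z t \<in> V})"
      using u by (intro openin_Int) auto
    moreover have "\<gamma> \<in> {z \<in> topspace P. z s \<in> U} \<inter> {z \<in> topspace P. z t \<in> V}"
      using u \<gamma>P by auto
    moreover have "\<exists>z. z \<in> Q u \<and> z \<in> T" if "openin P T" "\<gamma> \<in> T" for T
      using \<gamma>[OF u(1)] that by (simp add: in_closure_of)
    ultimately have "\<exists>z. z \<in> Q u \<and> z \<in> {z \<in> topspace P. z s \<in> U} \<inter> {z \<in> topspace P. z t \<in> V}"
      by presburger
    then show ?thesis
      by blast
  qed
  show thesis
  proof (rule that)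
    show "\<gamma> 0 = x"
    proof (rule ccontr)
      \<comment> \<open>Separate \<open>\<gamma> 0\<close> from \<open>x\<close> by disjoint open
        sets: some curve starting in \<open>U\<close> would also have its starting point in
        \<open>W\<close>. The other end is treated alike.\<close>
      assume "\<gamma> 0 \<noteq> x"
      moreover have 0: "0 \<in> {0..d}"
        using d by auto
      ultimately obtain W U where "openin X W" "openin X U" "\<gamma> 0 \<in> W" "x \<in> U" "disjnt W U"
        using X \<gamma>Y[OF 0] x YX unfolding Hausdorff_space_def by (metis subsetD)
      then show False
        using near[of "(U, topspace X, 1)" 0 0 W W] 0 y YX by (auto simp: N_def Q_def disjnt_def)
    qed
    show "\<gamma> d = y"
    proof (rule ccontr)
      assume "\<gamma> d \<noteq> y"
      moreover have 0: "d \<in> {0..d}"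
        using d by auto
      ultimately obtain W U where "openin X W" "openin X U" "\<gamma> d \<in> W" "y \<in> U" "disjnt W U"
        using X \<gamma>Y[OF 0] y YX unfolding Hausdorff_space_def by (metis subsetD)
      then show False
        using near[of "(topspace X, U, 1)" d d W W] 0 x YX by (auto simp: N_def Q_def disjnt_def)
    qed
    fix s t assume s: "s \<in> {0..d}" and t: "t \<in> {0..d}" and st: "s \<le> t"
    show "liminf_dist X I D (\<gamma> s) (\<gamma> t) \<le> ereal (t - s)"
    proof (rule ccontr)
      assume "\<not> ?thesis"
      then obtain c where c: "ereal (t - s) < ereal c" "ereal c < liminf_dist X I D (\<gamma> s) (\<gamma> t)"
        using ereal_dense2 not_le by metis
      have "\<gamma> s \<in> topspace X" "\<gamma> t \<in> topspace X"
        using \<gamma>Y s t YX by auto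
      then obtain U V where UV: "openin X U" "\<gamma> s \<in> U" "openin X V" "\<gamma> t \<in> V"
        "\<And>x' y'. x' \<in> U \<inter> I \<Longrightarrow> y' \<in> V \<inter> I \<Longrightarrow> ereal c < D x' y'"
        using less_liminf_distE[OF c(2)] by metis
      \<comment> \<open>With tolerance \<open>c - (t - s)\<close> the estimate for the approximating
        curve reads \<open>D (z s) (z t) \<le> c\<close>, whereas \<open>U\<close> and
        \<open>V\<close> force \<open>D\<close> above \<open>c\<close>.\<close>
      have "(topspace X, topspace X, c - (t - s)) \<in> N"
        using c(1) x y YX by (auto simp: N_def)
      from near[OF this s t UV(1-4)] obtain z where z: "z \<in> Q (topspace X, topspace X, c - (t - s))"
        "z s \<in> U" "z t \<in> V"
        by blast
      have "z s \<in> I" "z t \<in> I"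
        using z(1) s t by (auto simp: Q_def)
      moreover have "D (z s) (z t) \<le> ereal (t - s + (c - (t - s)))"
        using z(1) s t st unfolding Q_def by blast
      ultimately show False
        using UV(5)[of "z s" "z t"] z by (simp add: not_le[symmetric])
    qed
  qed (rule \<gamma>Y)
qed

section \<open>Existence of shortest curves for the lower limit distance\<close>

text \<open>The assumption \<open>split\<close> expresses that \<open>D\<close> is a length
  distance: any \<open>c\<close> above \<open>D p q\<close> is realized by a curve on which
  \<open>D\<close> grows at rate at most \<open>c\<close>. The strict inequality allows for an
  infimum that is not attained.\<close>

theorem liminf_dist_shortest_curve:
  assumes X: "Hausdorff_space X" and Y: "compactin X Y" and IY: "I \<subseteq> Y"
    and split: "\<And>p q c. p \<in> I \<Longrightarrow> q \<in> I \<Longrightarrow> D p q < ereal c \<Longrightarrow>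
      \<exists>z. z 0 = p \<and> z 1 = q \<and> (\<forall>s\<in>{0..1}. z s \<in> I) \<and>
        (\<forall>s\<in>{0..1}. \<forall>t\<in>{0..1}. s \<le> t \<longrightarrow> D (z s) (z t) \<le> ereal (c * (t - s)))"
    and fin: "\<And>p q. p \<in> Y \<Longrightarrow> q \<in> Y \<Longrightarrow> \<bar>liminf_dist X I D p q\<bar> \<noteq> \<infinity>"
    and metric: "Metric_space Y (\<lambda>p q. real_of_ereal (liminf_dist X I D p q))"
    and x: "x \<in> Y" and y: "y \<in> Y"
  obtains L \<gamma> where "0 \<le> L" "continuous_map (top_of_set {0..L}) (subtopology X Y) \<gamma>"
    "\<gamma> 0 = x" "\<gamma> L = y"
    "\<And>s t. s \<in> {0..L} \<Longrightarrow> t \<in> {0..L} \<Longrightarrow> s < t \<Longrightarrow>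
       liminf_dist X I D (\<gamma> s) (\<gamma> t) = ereal (t - s)"
proof -
  have YX: "Y \<subseteq> topspace X"
    using Y compactin_subset_topspace by blast
  interpret Metric_space Y "\<lambda>p q. real_of_ereal (liminf_dist X I D p q)"
    by (rule metric)
  define R where "R = (\<lambda>p q. real_of_ereal (liminf_dist X I D p q))"
  have R: "liminf_dist X I D p q = ereal (R p q)" if "p \<in> Y" "q \<in> Y" for p q
    using fin[OF that] by (simp add: R_def ereal_real)
  define d where "d = R x y"
  have d: "0 \<le> d"
    using nonneg by (simp add: d_def R_def)
  have R0: "R p q = 0 \<longleftrightarrow> p = q" if "p \<in> Y" "q \<in> Y" for p q
    using that by (simp add: R_def)
  show thesis
  \<comment> \<open>The rescaling from \<open>{0..1}\<close> to \<open>{0..d}\<close> divides by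
    \<open>d\<close>; for \<open>d = 0\<close> the end points coincide and a constant curve
    serves.\<close>
  proof (cases "d = 0")
    case True
    then have "x = y"
      using R0 x y by (simp add: d_def)
    then show thesis
      using x YX by (intro that[of 0 "\<lambda>_. x"]) auto
  next
    case False
    with d have dpos: "0 < d"
      by simp
    have ex: "\<exists>z. z 0 \<in> U \<and> z d \<in> V \<and> (\<forall>s\<in>{0..d}. z s \<in> I) \<and>
        (\<forall>s\<in>{0..d}. \<forall>t\<in>{0..d}. s \<le> t \<longrightarrow> D (z s) (z t) \<le> ereal (t - s + e))"
      if UV: "openin X U" "x \<in> U" "openin X V" "y \<in> V" "0 < e" for U V e
    proof -
      \<comment> \<open>If \<open>D\<close> were at least \<open>d + e\<close> on all interior pairs
        from \<open>U\<close> and \<open>V\<close>, so would be the lower limit, which equals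
        \<open>d\<close>.\<close>
      have "\<not> ereal (d + e) \<le> liminf_dist X I D x y"
        using UV R[OF x y] by (simp add: d_def)
      then obtain p q where pq: "p \<in> U \<inter> I" "q \<in> V \<inter> I" "D p q < ereal (d + e)"
        using liminf_dist_geI[OF UV(1-4)] by (meson not_le)
      then obtain z where z: "z 0 = p" "z 1 = q" "\<And>s. s \<in> {0..1} \<Longrightarrow> z s \<in> I"
        "\<And>s t. s \<in> {0..1} \<Longrightarrow> t \<in> {0..1} \<Longrightarrow> s \<le> t \<Longrightarrow> D (z s) (z t) \<le> ereal ((d + e) * (t - s))"
        using split[of p q "d + e"] by auto
      have in01: "s / d \<in> {0..1}" if "s \<in> {0..d}" for s
        using that dpos by auto
      have "D (z (s / d)) (z (t / d)) \<le> ereal (t - s + e)"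
        if st: "s \<in> {0..d}" "t \<in> {0..d}" "s \<le> t" for s t
      proof -
        \<comment> \<open>After rescaling, the excess over \<open>t - s\<close> is
          \<open>e * ((t - s) / d)\<close>, at most \<open>e\<close> because
          \<open>t - s \<le> d\<close>.\<close>
        have "D (z (s / d)) (z (t / d)) \<le> ereal ((d + e) * (t / d - s / d))"
          using st dpos by (intro z(4) in01) (auto intro: divide_right_mono)
        also have "(d + e) * (t / d - s / d) = t - s + e * ((t - s) / d)"
          using dpos by (simp add: field_simps)
        also have "\<dots> \<le> t - s + e"
          using st dpos UV(5) mult_left_mono[of "(t - s) / d" 1 e] by simp
        finally show ?thesis
          by simp
      qed
      then show ?thesis
        using pq z in01 dpos by (intro exI[of _ "\<lambda>s. z (s / d)"]) auto
    qed
    obtain \<gamma> where \<gamma>: "\<gamma> 0 = x" "\<gamma> d = y" "\<And>s. s \<in> {0..d} \<Longrightarrow> \<gamma> s \<in> Y"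
      "\<And>s t. s \<in> {0..d} \<Longrightarrow> t \<in> {0..d} \<Longrightarrow> s \<le> t \<Longrightarrow>
         liminf_dist X I D (\<gamma> s) (\<gamma> t) \<le> ereal (t - s)"
      by (rule almost_geodesics_cluster[OF X Y IY x y d]) (erule (4) ex, blast)
    have le: "R (\<gamma> s) (\<gamma> t) \<le> t - s" if "s \<in> {0..d}" "t \<in> {0..d}" "s \<le> t" for s t
      using \<gamma>(3)[OF that(1)] \<gamma>(3)[OF that(2)] \<gamma>(4)[OF that] R by simp
    have eq: "R (\<gamma> s) (\<gamma> t) = t - s" if st: "s \<in> {0..d}" "t \<in> {0..d}" "s \<le> t" for s t
    proof -
      \<comment> \<open>Going from \<open>x\<close> to \<open>y\<close> through
        \<open>\<gamma> s\<close> and \<open>\<gamma> t\<close> gives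
        \<open>d \<le> s + R (\<gamma> s) (\<gamma> t) + (d - t)\<close>, so the upper bound
        \<open>t - s\<close> must be attained.\<close>
      have "d \<le> R x (\<gamma> s) + R (\<gamma> s) y"
        using triangle[of x "\<gamma> s" y] x y \<gamma>(3) st by (simp add: R_def d_def)
      moreover have "R (\<gamma> s) y \<le> R (\<gamma> s) (\<gamma> t) + R (\<gamma> t) y"
        using triangle[of "\<gamma> s" "\<gamma> t" y] x y \<gamma>(3) st by (simp add: R_def)
      moreover have "R x (\<gamma> s) \<le> s" "R (\<gamma> t) y \<le> d - t"
        using le[of 0 s] le[of t d] st \<gamma>(1,2) by auto
      ultimately show ?thesis
        using le[OF st] by linarith
    qed
    have cont: "continuous_map (top_of_set {0..d}) (subtopology X Y) \<gamma>"
    proof (rule lipschitz_into_liminf_dist_continuous[OF Y \<gamma>(3)])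
      show "0 < liminf_dist X I D p q" if "p \<in> Y" "q \<in> Y" "p \<noteq> q" for p q
      proof -
        have "0 < R p q"
          using R0[OF that(1,2)] that(3) nonneg[of p q] unfolding R_def by linarith
        then show ?thesis
          using R that by simp
      qed
      show "liminf_dist X I D (\<gamma> s) (\<gamma> t) \<le> ereal \<bar>s - t\<bar>" if "s \<in> {0..d}" "t \<in> {0..d}" for s t
      proof -
        have "R (\<gamma> s) (\<gamma> t) = R (\<gamma> t) (\<gamma> s)"
          using commute by (simp add: R_def)
        then have "R (\<gamma> s) (\<gamma> t) = \<bar>s - t\<bar>"
          using eq[of s t] eq[of t s] that by (cases "s \<le> t") auto
        then show ?thesis
          using R \<gamma>(3) that by simp
      qed
    qed auto
    show thesis
      using that[OF d cont \<gamma>(1,2)] eq R \<gamma>(3) by simp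
  qed
qed

section \<open>Calculus of smooth maps\<close>

text \<open>On an open set the derivative at a point is determined by values in the set, so equality
  of functions passes to their directional derivatives and the induction proceeds.\<close>

lemma Ck_on_cong:
  assumes "open N" "\<And>x. x \<in> N \<Longrightarrow> f x = h x" "Ck_on k N f"
  shows "Ck_on k N h"
  using assms(2,3)
proof (induction k arbitrary: f h)
  case 0
  then show ?case
    using continuous_on_cong by force
next
  case (Suc k)
  have D: "(h has_derivative frechet_derivative f (at x)) (at x)" if "x \<in> N" for x
    using Suc.prems that \<open>open N\<close>
    by (auto intro: has_derivative_transform_within_open simp: frechet_derivative_works)
  then have "frechet_derivative h (at x) = frechet_derivative f (at x)" if "x \<in> N" for x
    using that frechet_derivative_at by metis
  then have "Ck_on k N (\<lambda>x. frechet_derivative h (at x) v)" for v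
    using Suc.IH[of "\<lambda>x. frechet_derivative f (at x) v"] Suc.prems(2) by simp
  then show ?case
    using D by (auto simp: differentiable_def)
qed

lemma Ck_on_subset: "Ck_on k N f \<Longrightarrow> M \<subseteq> N \<Longrightarrow> Ck_on k M f"
proof (induction k arbitrary: f)
  case 0
  then show ?case
    using continuous_on_subset by auto
next
  case (Suc k)
  then show ?case
    unfolding Ck_on.simps by blast
qed

text \<open>By the chain rule, differentiating the composite in direction \<open>v\<close> gives the
  derivative of \<open>f\<close> in direction \<open>m * v\<close>, composed with the same affine
  map; the induction hypothesis applies to it. The degenerate slope \<open>m = 0\<close> is
  covered.\<close>

lemma Ck_on_compose_affine:
  fixes f :: "real \<Rightarrow> 'b::real_normed_vector"
  assumes "open N" "Ck_on k N f"
  shows "Ck_on k ((\<lambda>u. a + m * u) -` N) (\<lambda>u. f (a + m * u))"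
  using assms(2)
proof (induction k arbitrary: f)
  case 0
  then show ?case
    by (auto intro!: continuous_intros continuous_on_compose2[of N f])
next
  case (Suc k)
  let ?M = "(\<lambda>u. a + m * u) -` N"
  have M: "open ?M"
    using \<open>open N\<close> by (intro open_vimage continuous_intros) auto
  have D: "((\<lambda>u. f (a + m * u)) has_derivative (\<lambda>v. frechet_derivative f (at (a + m * u)) (m * v))) (at u)"
    if "u \<in> ?M" for u
  proof -
    have "(f has_derivative frechet_derivative f (at (a + m * u))) (at (a + m * u))"
      using Suc.prems that by (simp add: frechet_derivative_works)
    moreover have "((\<lambda>u. a + m * u) has_derivative (\<lambda>v. m * v)) (at u)"
      by (auto intro!: derivative_eq_intros)
    ultimately show ?thesis
      using has_derivative_compose by blast
  qed
  have "Ck_on k ?M (\<lambda>u. frechet_derivative (\<lambda>u. f (a + m * u)) (at u) v)" for v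
  proof (rule Ck_on_cong[OF M])
    show "Ck_on k ?M (\<lambda>u. frechet_derivative f (at (a + m * u)) (m * v))"
      using Suc.IH[of "\<lambda>x. frechet_derivative f (at x) (m * v)"] Suc.prems by simp
    show "frechet_derivative f (at (a + m * u)) (m * v) = frechet_derivative (\<lambda>u. f (a + m * u)) (at u) v"
      if "u \<in> ?M" for u
      using frechet_derivative_at[OF D[OF that]] by metis
  qed
  then show ?case
    using D by (auto simp: differentiable_def)
qed

lemma smooth_on_compose_affine:
  fixes f :: "real \<Rightarrow> 'b::real_normed_vector"
  assumes "smooth_on S f" "\<And>u. u \<in> T \<Longrightarrow> a + m * u \<in> S"
  shows "smooth_on T (\<lambda>u. f (a + m * u))"
  unfolding smooth_on_def
proof
  fix u assume u: "u \<in> T"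
  then obtain N F where N: "open N" "a + m * u \<in> N" "\<And>k. Ck_on k N F"
    "\<And>y. y \<in> S \<inter> N \<Longrightarrow> F y = f y"
    using assms unfolding smooth_on_def by metis
  have "open ((\<lambda>u. a + m * u) -` N)"
    using N by (intro open_vimage continuous_intros) auto
  then show "\<exists>N F. open N \<and> u \<in> N \<and> (\<forall>k. Ck_on k N F) \<and> (\<forall>y\<in>T \<inter> N. F y = f (a + m * y))"
    using N assms(2) Ck_on_compose_affine[OF N(1) N(3)]
    by (intro exI[of _ "(\<lambda>u. a + m * u) -` N"] exI[of _ "\<lambda>u. F (a + m * u)"]) auto
qed

lemma smooth_on_imp_continuous_on:
  assumes "smooth_on S f"
  shows "continuous_on S f"
  unfolding continuous_on_eq_continuous_within
proof
  fix x assume x: "x \<in> S"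
  then obtain N F where N: "open N" "x \<in> N" "Ck_on 0 N F" "\<And>y. y \<in> S \<inter> N \<Longrightarrow> F y = f y"
    using assms unfolding smooth_on_def by metis
  have "continuous_on (S \<inter> N) F"
    using N(3) by (auto intro: continuous_on_subset)
  then have "continuous_on (S \<inter> N) f"
    using N(4) by (rule continuous_on_eq)
  then have "continuous (at x within S \<inter> N) f"
    using x N by (simp add: continuous_on_eq_continuous_within)
  moreover have "at x within S \<inter> N = at x within S"
    using N by (intro at_within_nhd[of _ N]) auto
  ultimately show "continuous (at x within S) f"
    by simp
qed

lemma smooth_on_open_differentiable:
  assumes "smooth_on S f" "open S" "x \<in> S"
  shows "f differentiable (at x)"
proof -
  obtain N F where N: "open N" "x \<in> N" "Ck_on (Suc 0) N F" "\<And>y. y \<in> S \<inter> N \<Longrightarrow> F y = f y"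
    using assms unfolding smooth_on_def by metis
  then obtain F' where F': "(F has_derivative F') (at x)"
    by (auto simp: differentiable_def)
  have "(f has_derivative F') (at x)"
    using N assms by (intro has_derivative_transform_within_open[OF F', of "S \<inter> N"]) auto
  then show ?thesis
    by (auto simp: differentiable_def)
qed

text \<open>\<open>metric_smooth\<close> speaks of fixed vectors. This expansion reduces the metric
  on a varying velocity vector to its coefficients on basis vectors.\<close>

lemma bilinear_eq_sum_Basis:
  fixes h :: "'e::euclidean_space \<Rightarrow> 'e \<Rightarrow> real"
  assumes "bilinear h"
  shows "h v w = (\<Sum>i\<in>Basis. \<Sum>j\<in>Basis. (v \<bullet> i) * (w \<bullet> j) * h i j)"
proof -
  have "h v w = h (\<Sum>i\<in>Basis. (v \<bullet> i) *\<^sub>R i) (\<Sum>j\<in>Basis. (w \<bullet> j) *\<^sub>R j)"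
    by (simp add: euclidean_representation)
  also have "\<dots> = (\<Sum>(i, j)\<in>Basis \<times> Basis. h ((v \<bullet> i) *\<^sub>R i) ((w \<bullet> j) *\<^sub>R j))"
    by (rule bilinear_sum[OF assms])
  also have "\<dots> = (\<Sum>i\<in>Basis. \<Sum>j\<in>Basis. (v \<bullet> i) * (w \<bullet> j) * h i j)"
    by (simp add: sum.cartesian_product bilinear_lmul[OF assms] bilinear_rmul[OF assms] mult_ac)
  finally show ?thesis .
qed

section \<open>Smooth paths in a Riemannian manifold\<close>

context smooth_manifold
begin

section \<open>Charts and transition maps\<close>

lemma chart_image_open:
  assumes c: "c \<in> A" and W: "openin X W" "W \<subseteq> fst c"
  shows "open (snd c ` W)"
proof -
  have "openin X (fst c)" "open (snd c ` fst c)"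
    and hom: "homeomorphic_map (subtopology X (fst c)) (top_of_set (snd c ` fst c)) (snd c)"
    using charts[OF c] by (auto simp: is_chart_def split: prod.splits)
  moreover have "openin (subtopology X (fst c)) W"
    using W by (simp add: openin_subset_topspace_eq openin_subtopology) blast
  ultimately have "openin (top_of_set (snd c ` fst c)) (snd c ` W)"
    using homeomorphic_map_openness_eq by blast
  then show ?thesis
    using \<open>open (snd c ` fst c)\<close> openin_open_trans by blast
qed

lemma chart_openin: "c \<in> A \<Longrightarrow> openin X (fst c)"
  using charts[of c] by (auto simp: is_chart_def split: prod.splits)

lemma chart_inj_on:
  assumes "c \<in> A"
  shows "inj_on (snd c) (fst c)"
proof -
  have "openin X (fst c)"
    and "homeomorphic_map (subtopology X (fst c)) (top_of_set (snd c ` fst c)) (snd c)"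
    using charts[OF assms] by (auto simp: is_chart_def split: prod.splits)
  then show ?thesis
    using homeomorphic_imp_injective_map openin_subset by (metis topspace_subtopology_subset)
qed

lemma transition_chart:
  assumes "c \<in> A" "p \<in> fst c"
  shows "transition c c' (snd c p) = snd c' p"
  using inv_into_f_f[OF chart_inj_on] assms by (simp add: transition_def)

lemma transition_differentiable:
  assumes "c \<in> A" "c' \<in> A" "p \<in> fst c" "p \<in> fst c'"
  shows "transition c c' differentiable (at (snd c p))"
proof (rule smooth_on_open_differentiable[OF compatible[OF assms(1,2)]])
  show "open (snd c ` (fst c \<inter> fst c'))"
    using assms by (intro chart_image_open openin_Int chart_openin) auto
qed (use assms in auto)

section \<open>Smooth paths in coordinates\<close>

lemma path_near_chart:
  assumes \<gamma>: "pathin X \<gamma>" and c: "c \<in> A" and t: "t \<in> {0..1}" "\<gamma> t \<in> fst c"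
  obtains e where "0 < e" "\<And>s. s \<in> {0..1} \<Longrightarrow> dist s t < e \<Longrightarrow> \<gamma> s \<in> fst c"
proof -
  have "openin (top_of_set {0..1}) {s \<in> {0..1}. \<gamma> s \<in> fst c}"
    using openin_continuous_map_preimage[OF \<gamma>[unfolded pathin_def] chart_openin[OF c]] by simp
  then obtain e where "0 < e" "\<forall>s\<in>{0..1}. dist s t < e \<longrightarrow> s \<in> {s \<in> {0..1}. \<gamma> s \<in> fst c}"
    using t unfolding openin_euclidean_subtopology_iff by blast
  then show thesis
    using that by blast
qed

text \<open>The extension \<open>F\<close> is differentiable on an open set of reals. Its ordinary
  derivative represents the velocity also at 0 and 1, where only a one-sided derivative of the path
  exists, and makes the velocity continuous.\<close>

lemma smooth_path_local_extension:
  assumes \<gamma>: "smooth_path X A \<gamma>" and c: "c \<in> A" and t: "t \<in> {0..1}" "\<gamma> t \<in> fst c"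
  obtains N F where "open N" "t \<in> N" "\<And>k. Ck_on k N F"
    "\<And>s. s \<in> N \<inter> {0..1} \<Longrightarrow> \<gamma> s \<in> fst c \<and> snd c (\<gamma> s) = F s \<and>
       (snd c \<circ> \<gamma> has_vector_derivative frechet_derivative F (at s) 1) (at s within {0..1})"
proof -
  have "smooth_on {s \<in> {0..1}. \<gamma> s \<in> fst c} (snd c \<circ> \<gamma>)"
    using \<gamma> c by (simp add: smooth_path_def)
  then obtain M F where M: "open M" "t \<in> M" "\<And>k. Ck_on k M F"
    "\<And>s. s \<in> {s \<in> {0..1}. \<gamma> s \<in> fst c} \<inter> M \<Longrightarrow> F s = (snd c \<circ> \<gamma>) s"
    using t unfolding smooth_on_def by (metis (mono_tags, lifting) mem_Collect_eq)
  have p: "pathin X \<gamma>"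
    using \<gamma> by (simp add: smooth_path_def)
  obtain e where e: "0 < e" "\<And>s. s \<in> {0..1} \<Longrightarrow> dist s t < e \<Longrightarrow> \<gamma> s \<in> fst c"
    using path_near_chart[OF p c t] by metis
  \<comment> \<open>The ball keeps \<open>\<gamma>\<close> inside the chart domain, so that
    \<open>F\<close> agrees with the coordinate path on all of
    \<open>N \<inter> {0..1}\<close>.\<close>
  define N where "N = M \<inter> ball t e"
  have N: "open N" "t \<in> N" "\<And>k. Ck_on k N F"
    using M e Ck_on_subset[of _ M F N] by (auto simp: N_def)
  have F: "\<gamma> s \<in> fst c" "snd c (\<gamma> s) = F s" if "s \<in> N \<inter> {0..1}" for s
    using that M(4)[of s] e(2)[of s] by (auto simp: N_def dist_commute)
  show thesis
  proof (rule that[OF N])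
    fix s assume s: "s \<in> N \<inter> {0..1}"
    have "F differentiable (at s)"
      using N(3)[of "Suc 0"] s by simp
    then have F': "(F has_derivative frechet_derivative F (at s)) (at s within {0..1})"
      and lin: "linear (frechet_derivative F (at s))"
      by (auto intro: has_derivative_at_withinI linear_frechet_derivative simp: frechet_derivative_works)
    have "frechet_derivative F (at s) h = h *\<^sub>R frechet_derivative F (at s) 1" for h
      using linear_scale[OF lin, of h 1] by simp
    then have D: "(F has_vector_derivative frechet_derivative F (at s) 1) (at s within {0..1})"
      unfolding has_vector_derivative_def by (intro has_derivative_eq_rhs[OF F'] ext)
    obtain d where d: "0 < d" "ball s d \<subseteq> N"
      using N(1) s open_contains_ball by blast
    have "(snd c \<circ> \<gamma> has_vector_derivative frechet_derivative F (at s) 1) (at s within {0..1})"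
    proof (rule has_vector_derivative_transform_within[OF D d(1)])
      show "F r = (snd c \<circ> \<gamma>) r" if "r \<in> {0..1}" "dist r s < d" for r
        using F(2)[of r] that d(2) by (auto simp: dist_commute subset_iff)
    qed (use s in auto)
    then show "\<gamma> s \<in> fst c \<and> snd c (\<gamma> s) = F s \<and>
       (snd c \<circ> \<gamma> has_vector_derivative frechet_derivative F (at s) 1) (at s within {0..1})"
      using F[OF s] by simp
  qed
qed

lemma smooth_path_subpath:
  assumes \<gamma>: "smooth_path X A \<gamma>" and ab: "0 \<le> a" "a \<le> b" "b \<le> 1"
  shows "smooth_path X A (\<lambda>u. \<gamma> (a + (b - a) * u))"
proof -
  have in01: "a + (b - a) * u \<in> {0..1}" if "u \<in> {0..1}" for u
    using that ab mult_left_mono[of u 1 "b - a"] by auto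
  have aff: "continuous_map (top_of_set {0..1}) (top_of_set {0..1}) (\<lambda>u. a + (b - a) * u)"
    using in01 by (auto simp: continuous_map_in_subtopology intro!: continuous_intros)
  have "continuous_map (top_of_set {0..1}) X \<gamma>"
    using \<gamma> by (simp add: smooth_path_def pathin_def)
  from continuous_map_compose[OF aff this] have "pathin X (\<lambda>u. \<gamma> (a + (b - a) * u))"
    by (simp add: pathin_def o_def)
  moreover have "smooth_on {t \<in> {0..1}. \<gamma> (a + (b - a) * t) \<in> fst c} (snd c \<circ> (\<lambda>u. \<gamma> (a + (b - a) * u)))"
    if "c \<in> A" for c
  proof -
    have "smooth_on {t \<in> {0..1}. \<gamma> t \<in> fst c} (snd c \<circ> \<gamma>)"
      using \<gamma> that by (simp add: smooth_path_def)
    from smooth_on_compose_affine[OF this, of "{t \<in> {0..1}. \<gamma> (a + (b - a) * t) \<in> fst c}" a "b - a"]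
    show ?thesis
      using in01 by (simp add: o_def)
  qed
  ultimately show ?thesis
    by (simp add: smooth_path_def)
qed

end

context riemannian_manifold
begin

section \<open>Speed and length of smooth paths\<close>

text \<open>The chart \<open>c0\<close> selected in \<open>speed\<close> is related to
  \<open>c\<close> by the transition map. The chain rule carries the velocity \<open>v\<close> to
  \<open>D v\<close>, and \<open>metric_transforms\<close> shows that its norm is unchanged.\<close>

lemma speed_eq_in_chart:
  assumes \<gamma>: "pathin X \<gamma>" and c: "c \<in> A" and t: "t \<in> {0..1}" "\<gamma> t \<in> fst c"
    and v: "(snd c \<circ> \<gamma> has_vector_derivative v) (at t within {0..1})"
  shows "speed A g \<gamma> t = sqrt (g c (\<gamma> t) v v)"
proof -
  define c0 where "c0 = (SOME c. c \<in> A \<and> \<gamma> t \<in> fst c)"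
  have c0: "c0 \<in> A" "\<gamma> t \<in> fst c0"
    using c t someI[of "\<lambda>c. c \<in> A \<and> \<gamma> t \<in> fst c" c] by (auto simp: c0_def)
  define D where "D = frechet_derivative (transition c c0) (at (snd c (\<gamma> t)))"
  have "(transition c c0 has_derivative D) (at (snd c (\<gamma> t)))"
    using transition_differentiable[OF c c0(1) t(2) c0(2)] by (simp add: D_def frechet_derivative_works)
  then have "(transition c c0 has_derivative D) (at ((snd c \<circ> \<gamma>) t) within (snd c \<circ> \<gamma>) ` {0..1})"
    by (simp add: has_derivative_at_withinI)
  from vector_derivative_diff_chain_within[OF v this]
  have D: "(transition c c0 \<circ> (snd c \<circ> \<gamma>) has_vector_derivative D v) (at t within {0..1})" .
  obtain e where e: "0 < e" "\<And>s. s \<in> {0..1} \<Longrightarrow> dist s t < e \<Longrightarrow> \<gamma> s \<in> fst c"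
    using path_near_chart[OF \<gamma> c t] by metis
  have "(snd c0 \<circ> \<gamma> has_vector_derivative D v) (at t within {0..1})"
    using D e(1) t(1)
  proof (rule has_vector_derivative_transform_within)
    show "(transition c c0 \<circ> (snd c \<circ> \<gamma>)) s = (snd c0 \<circ> \<gamma>) s" if "s \<in> {0..1}" "dist s t < e" for s
      using e(2)[OF that] c by (simp add: transition_chart)
  qed
  then have "vector_derivative (snd c0 \<circ> \<gamma>) (at t within {0..1}) = D v"
    using t(1) by (intro vector_derivative_within_closed_interval) auto
  then have "speed A g \<gamma> t = sqrt (g c0 (\<gamma> t) (D v) (D v))"
    by (simp add: speed_def Let_def c0_def)
  then show ?thesis
    using metric_transforms[OF c c0(1) t(2) c0(2)] by (simp add: D_def)
qed

lemma pathin_chart: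
  assumes "pathin X \<gamma>" "t \<in> {0..1}"
  obtains c where "c \<in> A" "\<gamma> t \<in> fst c"
proof -
  have "\<gamma> t \<in> topspace X"
    using assms continuous_map_image_subset_topspace unfolding pathin_def by fastforce
  then show thesis
    using covers that by blast
qed

lemma speed_nonneg:
  assumes \<gamma>: "smooth_path X A \<gamma>" and t: "t \<in> {0..1}"
  shows "0 \<le> speed A g \<gamma> t"
proof -
  have p: "pathin X \<gamma>"
    using \<gamma> by (simp add: smooth_path_def)
  obtain c where c: "c \<in> A" "\<gamma> t \<in> fst c"
    using pathin_chart[OF p t] .
  obtain v where "(snd c \<circ> \<gamma> has_vector_derivative v) (at t within {0..1})"
    using smooth_path_local_extension[OF \<gamma> c(1) t c(2)] t by (metis IntI)
  \<comment> \<open>\<open>metric_pos\<close> concerns nonzero vectors, so zero velocity is a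
    separate case.\<close>
  from speed_eq_in_chart[OF p c(1) t c(2) this] show ?thesis
    using metric_pos[OF c, of v] bilinear_lzero[OF metric_bilinear[OF c], of v] by (cases "v = 0") auto
qed

text \<open>The chart selected in \<open>speed\<close> may jump with the parameter. Near a given
  \<open>t\<close> one fixed chart is used instead, in which the speed is a formula in the
  continuous velocity \<open>V\<close> and the metric coefficients \<open>G i j\<close> along the
  path.\<close>

lemma speed_continuous_on:
  assumes \<gamma>: "smooth_path X A \<gamma>"
  shows "continuous_on {0..1} (speed A g \<gamma>)"
  unfolding continuous_on_eq_continuous_within
proof
  have p: "pathin X \<gamma>"
    using \<gamma> by (simp add: smooth_path_def)
  fix t :: real assume t: "t \<in> {0..1}"
  obtain c where c: "c \<in> A" "\<gamma> t \<in> fst c"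
    using pathin_chart[OF p t] .
  obtain N F where N: "open N" "t \<in> N" "\<And>k. Ck_on k N F"
    and F: "\<And>s. s \<in> N \<inter> {0..1} \<Longrightarrow> \<gamma> s \<in> fst c \<and> snd c (\<gamma> s) = F s \<and>
       (snd c \<circ> \<gamma> has_vector_derivative frechet_derivative F (at s) 1) (at s within {0..1})"
    using smooth_path_local_extension[OF \<gamma> c(1) t c(2)] by metis
  define V where "V = (\<lambda>s. frechet_derivative F (at s) 1)"
  define G where "G = (\<lambda>i j u. g c (inv_into (fst c) (snd c) u) i j)"
  have "continuous_on N V" "continuous_on N F"
    using N(3)[of "Suc 0"] N(3)[of 0] by (auto simp: V_def)
  then have V: "continuous_on (N \<inter> {0..1}) V" and Fc: "continuous_on (N \<inter> {0..1}) F"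
    by (auto intro: continuous_on_subset)
  have G: "continuous_on (N \<inter> {0..1}) (\<lambda>s. G i j (F s))" for i j
  proof (rule continuous_on_compose2[OF _ Fc])
    show "continuous_on (snd c ` fst c) (G i j)"
      unfolding G_def by (rule smooth_on_imp_continuous_on[OF metric_smooth[OF c(1)]])
    show "F ` (N \<inter> {0..1}) \<subseteq> snd c ` fst c"
    proof clarify
      fix s :: real assume "s \<in> N" "s \<in> {0..1}"
      then have "\<gamma> s \<in> fst c" "F s = snd c (\<gamma> s)"
        using F[of s] by simp_all
      then show "F s \<in> snd c ` fst c"
        by simp
    qed
  qed
  have eq: "speed A g \<gamma> s = sqrt (\<Sum>i\<in>Basis. \<Sum>j\<in>Basis. (V s \<bullet> i) * (V s \<bullet> j) * G i j (F s))"
    if s: "s \<in> N \<inter> {0..1}" for s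
  proof -
    have c': "\<gamma> s \<in> fst c" "snd c (\<gamma> s) = F s"
      and "(snd c \<circ> \<gamma> has_vector_derivative V s) (at s within {0..1})"
      using F[OF s] by (auto simp: V_def)
    then have "speed A g \<gamma> s = sqrt (g c (\<gamma> s) (V s) (V s))"
      using speed_eq_in_chart[OF p c(1)] s by blast
    moreover have "inv_into (fst c) (snd c) (F s) = \<gamma> s"
      using c' chart_inj_on[OF c(1)] by (metis inv_into_f_f)
    ultimately show ?thesis
      using bilinear_eq_sum_Basis[OF metric_bilinear[OF c(1) c'(1)], of "V s" "V s"]
      by (simp only: G_def)
  qed
  have "continuous_on (N \<inter> {0..1})
      (\<lambda>s. sqrt (\<Sum>i\<in>Basis. \<Sum>j\<in>Basis. (V s \<bullet> i) * (V s \<bullet> j) * G i j (F s)))"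
    by (intro continuous_intros V G)
  then have "continuous_on (N \<inter> {0..1}) (speed A g \<gamma>)"
    by (rule continuous_on_eq) (simp only: eq)
  then have "continuous (at t within N \<inter> {0..1}) (speed A g \<gamma>)"
    using t N by (simp add: continuous_on_eq_continuous_within)
  moreover have "at t within N \<inter> {0..1} = at t within {0..1}"
    using N by (intro at_within_nhd[of _ N]) auto
  ultimately show "continuous (at t within {0..1}) (speed A g \<gamma>)"
    by simp
qed

text \<open>The reparametrization multiplies the speed by \<open>b - a\<close>, which the
  substitution in the integral cancels.\<close>

lemma path_len_subpath:
  assumes \<gamma>: "smooth_path X A \<gamma>" and ab: "0 \<le> a" "a \<le> b" "b \<le> 1"
  shows "path_len A g (\<lambda>u. \<gamma> (a + (b - a) * u)) = integral {a..b} (speed A g \<gamma>)"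
proof -
  let ?\<gamma> = "\<lambda>u. \<gamma> (a + (b - a) * u)"
  have p: "pathin X \<gamma>" and p': "pathin X ?\<gamma>"
    using \<gamma> smooth_path_subpath[OF \<gamma> ab] by (simp_all add: smooth_path_def)
  have in01: "a + (b - a) * u \<in> {0..1}" if "u \<in> {0..1}" for u
    using that ab mult_left_mono[of u 1 "b - a"] by auto
  have eq: "speed A g ?\<gamma> u = (b - a) * speed A g \<gamma> (a + (b - a) * u)" if u: "u \<in> {0..1}" for u
  proof -
    define s where "s = a + (b - a) * u"
    have s: "s \<in> {0..1}"
      using in01[OF u] by (simp add: s_def)
    obtain c where c: "c \<in> A" "\<gamma> s \<in> fst c"
      using pathin_chart[OF p s] .
    obtain v where v: "(snd c \<circ> \<gamma> has_vector_derivative v) (at s within {0..1})"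
      using smooth_path_local_extension[OF \<gamma> c(1) s c(2)] s by (metis IntI)
    have "((\<lambda>u. a + (b - a) * u) has_vector_derivative (b - a)) (at u within {0..1})"
      by (auto intro!: derivative_eq_intros simp: has_real_derivative_iff_has_vector_derivative[symmetric])
    moreover have "(snd c \<circ> \<gamma> has_vector_derivative v) (at s within (\<lambda>u. a + (b - a) * u) ` {0..1})"
      using in01 by (intro has_vector_derivative_within_subset[OF v]) auto
    ultimately have "((snd c \<circ> \<gamma>) \<circ> (\<lambda>u. a + (b - a) * u) has_vector_derivative (b - a) *\<^sub>R v) (at u within {0..1})"
      unfolding s_def by (rule vector_diff_chain_within)
    then have "(snd c \<circ> ?\<gamma> has_vector_derivative (b - a) *\<^sub>R v) (at u within {0..1})"
      by (simp add: o_def)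
    then have "speed A g ?\<gamma> u = sqrt (g c (\<gamma> s) ((b - a) *\<^sub>R v) ((b - a) *\<^sub>R v))"
      using speed_eq_in_chart[OF p' c(1) u] c(2) by (simp add: s_def)
    also have "\<dots> = sqrt ((b - a)\<^sup>2 * g c (\<gamma> s) v v)"
      using metric_bilinear[OF c] by (simp add: bilinear_lmul bilinear_rmul power2_eq_square)
    also have "\<dots> = (b - a) * speed A g \<gamma> s"
      using speed_eq_in_chart[OF p c(1) s c(2) v] ab by (simp add: real_sqrt_mult)
    finally show ?thesis
      by (simp add: s_def)
  qed
  then have len: "path_len A g ?\<gamma> = integral {0..1} (\<lambda>u. (b - a) * speed A g \<gamma> (a + (b - a) * u))"
    unfolding path_len_def by (intro integral_cong) auto
  show ?thesis
  \<comment> \<open>The substitution is singular for \<open>a = b\<close>; there both sides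
    vanish.\<close>
  proof (cases "a = b")
    case True
    then show ?thesis
      using len by simp
  next
    case False
    then have m: "0 < b - a"
      using ab by simp
    have "speed A g \<gamma> integrable_on {a..b}"
      using speed_continuous_on[OF \<gamma>] ab
      by (intro integrable_continuous_real) (auto intro: continuous_on_subset)
    then have "(speed A g \<gamma> has_integral integral {a..b} (speed A g \<gamma>)) (cbox a b)"
      by (simp add: integrable_integral)
    from has_integral_affinity'[OF this m, of a]
    have "((\<lambda>u. speed A g \<gamma> (a + (b - a) * u)) has_integral integral {a..b} (speed A g \<gamma>) / (b - a)) {0..1}"
      using m by (simp add: add.commute divide_inverse mult.commute)
    from has_integral_mult_right[OF this, of "b - a"] show ?thesis
      unfolding len using m by (intro integral_unique) simp
  qed
qed

section \<open>Arc length parametrization and almost geodesics for \<open>path_dist\<close>\<close>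

lemma path_dist_le_integral_speed:
  assumes \<gamma>: "smooth_path X A \<gamma>" "\<gamma> ` {0..1} \<subseteq> S" and ab: "0 \<le> a" "a \<le> b" "b \<le> 1"
  shows "path_dist X A g S (\<gamma> a) (\<gamma> b) \<le> ereal (integral {a..b} (speed A g \<gamma>))"
proof -
  have "(\<lambda>u. \<gamma> (a + (b - a) * u)) ` {0..1} \<subseteq> S"
  proof -
    have "a + (b - a) * u \<in> {0..1}" if "u \<in> {0..1}" for u
      using that ab mult_left_mono[of u 1 "b - a"] by auto
    then show ?thesis
      using \<gamma>(2) by auto
  qed
  then have "path_dist X A g S (\<gamma> a) (\<gamma> b) \<le> ereal (path_len A g (\<lambda>u. \<gamma> (a + (b - a) * u)))"
    unfolding path_dist_def using smooth_path_subpath[OF \<gamma>(1) ab] by (intro INF_lower) auto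
  then show ?thesis
    using path_len_subpath[OF \<gamma>(1) ab] by simp
qed

text \<open>The curve \<open>z\<close> is a smooth path parametrized proportionally to arc length; it need not be smooth.\<close>

lemma path_dist_less_imp_almost_geodesic:
  assumes "path_dist X A g S p q < ereal c"
  shows "\<exists>z. z 0 = p \<and> z 1 = q \<and> (\<forall>s\<in>{0..1}. z s \<in> S) \<and>
    (\<forall>s\<in>{0..1}. \<forall>t\<in>{0..1}. s \<le> t \<longrightarrow> path_dist X A g S (z s) (z t) \<le> ereal (c * (t - s)))"
proof -
  obtain \<gamma> where \<gamma>: "smooth_path X A \<gamma>" "\<gamma> ` {0..1} \<subseteq> S" "\<gamma> 0 = p" "\<gamma> 1 = q" "path_len A g \<gamma> < c"
    using assms unfolding path_dist_def by (auto simp: INF_less_iff)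
  \<comment> \<open>\<open>F\<close> is the arc length function and \<open>l\<close> the total
    length.\<close>
  define F where "F = (\<lambda>u. integral {0..u} (speed A g \<gamma>))"
  define l where "l = F 1"
  have l: "l < c"
    using \<gamma>(5) by (simp add: l_def F_def path_len_def)
  have int: "speed A g \<gamma> integrable_on {a..b}" if "0 \<le> a" "b \<le> 1" for a b
    using speed_continuous_on[OF \<gamma>(1)] that
    by (intro integrable_continuous_real) (auto intro: continuous_on_subset)
  have F_diff: "F b - F a = integral {a..b} (speed A g \<gamma>)" if "0 \<le> a" "a \<le> b" "b \<le> 1" for a b
    using Henstock_Kurzweil_Integration.integral_combine[where a = 0 and c = a and b = b and f = "speed A g \<gamma>"] int that by (simp add: F_def)
  have F_mono: "F a \<le> F b" if "0 \<le> a" "a \<le> b" "b \<le> 1" for a b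
  proof -
    have "0 \<le> integral {a..b} (speed A g \<gamma>)"
      using int that speed_nonneg[OF \<gamma>(1)] by (intro integral_nonneg) auto
    then show ?thesis
      using F_diff[OF that] by linarith
  qed
  have F0: "F 0 = 0"
    by (simp add: F_def)
  have F_cont: "continuous_on {0..1} F"
    unfolding F_def using int by (intro indefinite_integral_continuous_1) auto
  \<comment> \<open>The speed may vanish on intervals, so \<open>F\<close> need not be injective and
    the intermediate value theorem does not determine \<open>u\<close>. The extra clauses fix the
    end points and, for length zero, select the identity.\<close>
  have "\<exists>u\<in>{0..1}. F u = s * l \<and> (s = 0 \<longrightarrow> u = 0) \<and> (s = 1 \<longrightarrow> u = 1) \<and> (l = 0 \<longrightarrow> u = s)"
    if s: "s \<in> {0..1}" for s
  proof -
    have l0: "0 \<le> l"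
      using F_mono[of 0 1] F0 by (simp add: l_def)
    consider "l = 0" | "s = 0" | "s = 1" | "l \<noteq> 0" "s \<noteq> 0" "s \<noteq> 1"
      by blast
    then show ?thesis
    proof cases
      case 1
      then have "F s = 0"
        using F_mono[of 0 s] F_mono[of s 1] s F0 by (auto simp: l_def)
      then show ?thesis
        using 1 s by auto
    next
      case 4
      then obtain u where "0 \<le> u" "u \<le> 1" "F u = s * l"
        using IVT'[of F 0 "s * l" 1] F0 l0 s F_cont mult_right_mono[of s 1 l] by (auto simp: l_def)
      then show ?thesis
        using 4 by auto
    qed (use F0 in \<open>auto simp: l_def\<close>)
  qed
  then obtain \<tau> where \<tau>: "\<And>s. s \<in> {0..1} \<Longrightarrow> \<tau> s \<in> {0..1} \<and> F (\<tau> s) = s * l \<and>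
      (s = 0 \<longrightarrow> \<tau> s = 0) \<and> (s = 1 \<longrightarrow> \<tau> s = 1) \<and> (l = 0 \<longrightarrow> \<tau> s = s)"
    by metis
  have "path_dist X A g S (\<gamma> (\<tau> s)) (\<gamma> (\<tau> t)) \<le> ereal (c * (t - s))"
    if st: "s \<in> {0..1}" "t \<in> {0..1}" "s \<le> t" for s t
  proof -
    \<comment> \<open>A reversal would give \<open>t * l \<le> s * l\<close>, hence
      \<open>l = 0\<close> or \<open>s = t\<close>. In the first case \<open>\<tau>\<close> is the
      identity; in both no reversal is possible.\<close>
    have "\<tau> s \<le> \<tau> t"
    proof (rule ccontr)
      assume "\<not> \<tau> s \<le> \<tau> t"
      then have less: "\<tau> t < \<tau> s"
        by simp
      then have "t * l \<le> s * l"
        using F_mono[of "\<tau> t" "\<tau> s"] \<tau>[OF st(1)] \<tau>[OF st(2)] by auto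
      moreover have "0 \<le> l"
        using F_mono[of 0 1] F0 by (simp add: l_def)
      ultimately have "l = 0 \<or> s = t"
        using st(3) by (metis antisym mult_le_cancel_right_pos order_le_less)
      then show False
        using less st(3) \<tau>[OF st(1)] \<tau>[OF st(2)] by auto
    qed
    then have "path_dist X A g S (\<gamma> (\<tau> s)) (\<gamma> (\<tau> t)) \<le> ereal (F (\<tau> t) - F (\<tau> s))"
      using path_dist_le_integral_speed[OF \<gamma>(1,2), of "\<tau> s" "\<tau> t"] F_diff[of "\<tau> s" "\<tau> t"]
        \<tau>[OF st(1)] \<tau>[OF st(2)] by auto
    also have "F (\<tau> t) - F (\<tau> s) = l * (t - s)"
      using \<tau> st by (simp add: algebra_simps)
    also have "\<dots> \<le> c * (t - s)"
      using l st by (intro mult_right_mono) auto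
    finally show ?thesis
      by simp
  qed
  then show ?thesis
    using \<gamma>(2-4) \<tau> \<tau>[of 0] \<tau>[of 1] by (intro exI[of _ "\<lambda>s. \<gamma> (\<tau> s)"]) auto
qed

end

section \<open>Shortest curves for the intrinsic distance\<close>

theorem theorem3:
  fixes X :: "'a topology"
    and A :: "('a, 'e::euclidean_space) chart set"
    and g :: "('a, 'e) chart \<Rightarrow> 'a \<Rightarrow> 'e \<Rightarrow> 'e \<Rightarrow> real"
    and Y :: "'a set"
  assumes "2 \<le> DIM('e)"
    and "riemannian_manifold X A g" and "connected_space X"
    and "C0_submanifold TYPE('e) X Y"
    and "compactin X Y" and "connectedin X Y"
    and "manifold_boundary TYPE('e) (subtopology X Y) \<noteq> {}"
    and finite: "\<And>x y. \<lbrakk>x \<in> Y; y \<in> Y\<rbrakk> \<Longrightarrow> \<bar>rho X A g Y x y\<bar> \<noteq> \<infinity>"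
    and metric: "Metric_space Y (\<lambda>x y. real_of_ereal (rho X A g Y x y))"
    and "x \<in> Y" and "y \<in> Y"
  shows "\<exists>L \<gamma>. 0 \<le> L \<and> continuous_map (top_of_set {0..L}) (subtopology X Y) \<gamma> \<and>
           \<gamma> 0 = x \<and> \<gamma> L = y \<and>
           (\<forall>s\<in>{0..L}. \<forall>t\<in>{0..L}. s < t \<longrightarrow> rho X A g Y (\<gamma> s) (\<gamma> t) = ereal (t - s))"
proof -
  interpret riemannian_manifold X A g
    by fact
  define I where "I = manifold_interior TYPE('e) (subtopology X Y)"
  \<comment> \<open>Both sides are the same lower limit over pairs of interior points, so the
    general theorem applies, with the almost geodesics above supplying \<open>split\<close>.\<close>
  have rho: "rho X A g Y = liminf_dist X I (path_dist X A g I)"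
    by (intro ext) (simp add: rho_def liminf_dist_def I_def Let_def)
  have IY: "I \<subseteq> Y"
    by (auto simp: I_def manifold_interior_def)
  obtain L \<gamma> where "0 \<le> L" "continuous_map (top_of_set {0..L}) (subtopology X Y) \<gamma>"
    "\<gamma> 0 = x" "\<gamma> L = y"
    "\<And>s t. s \<in> {0..L} \<Longrightarrow> t \<in> {0..L} \<Longrightarrow> s < t \<Longrightarrow> rho X A g Y (\<gamma> s) (\<gamma> t) = ereal (t - s)"
    by (rule liminf_dist_shortest_curve[of X Y I "path_dist X A g I" x y, folded rho])
      (assumption | rule Hausdorff IY \<open>compactin X Y\<close> \<open>x \<in> Y\<close> \<open>y \<in> Y\<close> metric finite
         path_dist_less_imp_almost_geodesic that)+
  then show ?thesis
    by blast
qed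

end
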